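(* Let $X$ be a locally compact topological space homeomorphic to a subspace of a manifold. Let $\Phi$ be a $C^0$ flow on $X$ with a globally asymptotically stable equilibrium point $x_*\in X$. Then $(X,\Phi)$ is linearizable by a $C^0$ embedding.
   Context: Manifolds are, as usual, finite-dimensional, Hausdorff, second countable and without boundary. $C^0$ means continuous. A flow on $X$ is a group action $\Phi\colon \mathbb{R}\times X\to X$, $(t,x)\mapsto \Phi^t(x)$, of $(\mathbb{R},+)$ on $X$; it is $C^0$ if $\Phi$ is continuous. An equilibrium point is a point fixed by all $\Phi^t$. It is globally asymptotically stable if every neighborhood $U$ of $x_*$ contains a neighborhood $V$ of $x_*$ with $\Phi^t(V)\subset U$ for all $t\geq 0$, and $\Phi^t(x)\to x_*$ as $t\to\infty$ for every $x\in X$. A map $F\colon X\to\mathbb{R}^n$ is linearizing (for $\Phi$) if there is a matrix $B\in\mathbb{R}^{n\times n}$ such that $F\circ\Phi^t=e^{Bt}\circ F$ for all $t\in\mathbb{R}$. A $C^0$ embedding is a homeomorphism onto its image (with the subspace topology). $(X,\Phi)$ is linearizable by a $C^0$ embedding if for some $n\in\mathbb{N}$ there is a linearizing $C^0$ embedding $F\colon X\to\mathbb{R}^n$. *)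

theory Defs
  imports "HOL-Analysis.Analysis" "Jordan_Normal_Form.Matrix"
begin

definition topological_manifold :: "nat \<Rightarrow> 'm topology \<Rightarrow> bool" where
  "topological_manifold d M \<longleftrightarrow>
     Hausdorff_space M \<and> second_countable M \<and>
     (\<forall>p \<in> topspace M. \<exists>U V. openin M U \<and> p \<in> U \<and> openin (Euclidean_space d) V \<and>
        subtopology M U homeomorphic_space subtopology (Euclidean_space d) V)"

text \<open>Neighbourhoods are not required to be open.\<close>

definition nbhd_in :: "'a topology \<Rightarrow> 'a \<Rightarrow> 'a set \<Rightarrow> bool" where
  "nbhd_in X x N \<longleftrightarrow> N \<subseteq> topspace X \<and> (\<exists>W. openin X W \<and> x \<in> W \<and> W \<subseteq> N)"

text \<open>Only the values \<open>\<Phi> t x\<close> with \<open>x \<in> topspace X\<close> matter; continuity includes that each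
  \<open>\<Phi> t\<close> maps \<open>topspace X\<close> into itself.\<close>

definition C0_flow :: "'a topology \<Rightarrow> (real \<Rightarrow> 'a \<Rightarrow> 'a) \<Rightarrow> bool" where
  "C0_flow X \<Phi> \<longleftrightarrow>
     continuous_map (prod_topology euclideanreal X) X (\<lambda>(t, x). \<Phi> t x) \<and>
     (\<forall>x \<in> topspace X. \<Phi> 0 x = x) \<and>
     (\<forall>s t. \<forall>x \<in> topspace X. \<Phi> (s + t) x = \<Phi> s (\<Phi> t x))"

definition equilibrium_point :: "'a topology \<Rightarrow> (real \<Rightarrow> 'a \<Rightarrow> 'a) \<Rightarrow> 'a \<Rightarrow> bool" where
  "equilibrium_point X \<Phi> x0 \<longleftrightarrow> x0 \<in> topspace X \<and> (\<forall>t. \<Phi> t x0 = x0)"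

definition globally_asymptotically_stable ::
    "'a topology \<Rightarrow> (real \<Rightarrow> 'a \<Rightarrow> 'a) \<Rightarrow> 'a \<Rightarrow> bool" where
  "globally_asymptotically_stable X \<Phi> x0 \<longleftrightarrow>
     (\<forall>U. nbhd_in X x0 U \<longrightarrow>
        (\<exists>V. nbhd_in X x0 V \<and> V \<subseteq> U \<and> (\<forall>t\<ge>0. \<Phi> t ` V \<subseteq> U))) \<and>
     (\<forall>x \<in> topspace X. limitin X (\<lambda>t. \<Phi> t x) x0 at_top)"

text \<open>The exponential series is summed entrywise; it converges for every square matrix
  (\<open>mat_exp_summable\<close> below).\<close>

definition mat_exp :: "real mat \<Rightarrow> real mat" where
  "mat_exp A = Matrix.mat (dim_row A) (dim_row A)
     (\<lambda>(i, j). \<Sum>k. (A ^\<^sub>m k) $$ (i, j) / fact k)"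

lemma mat_exp_summable:
  fixes A :: "real mat"
  assumes A: "A \<in> carrier_mat n n" and ij: "i < n" "j < n"
  shows "summable (\<lambda>k. (A ^\<^sub>m k) $$ (i, j) / fact k)"
proof -
  define c where "c = (\<Sum>i<n. \<Sum>j<n. \<bar>A $$ (i, j)\<bar>)"
  have c: "\<bar>A $$ (i, j)\<bar> \<le> c" if "i < n" "j < n" for i j
  proof -
    have "\<bar>A $$ (i, j)\<bar> \<le> (\<Sum>j<n. \<bar>A $$ (i, j)\<bar>)"
      by (rule member_le_sum[of j "{..<n}" "\<lambda>j. \<bar>A $$ (i, j)\<bar>"]) (use that in auto)
    also have "\<dots> \<le> c" unfolding c_def
      by (rule member_le_sum[of i "{..<n}" "\<lambda>i. \<Sum>j<n. \<bar>A $$ (i, j)\<bar>"])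
        (use that in \<open>auto intro: sum_nonneg\<close>)
    finally show ?thesis .
  qed
  have bound: "\<bar>(A ^\<^sub>m k) $$ (i, j)\<bar> \<le> (real n * c) ^ k" if "i < n" "j < n" for i j k
    using that
  proof (induction k arbitrary: i j)
    case 0
    then show ?case using A by auto
  next
    case (Suc k)
    have P: "A ^\<^sub>m k \<in> carrier_mat n n" using A by simp
    have "(A ^\<^sub>m Suc k) $$ (i, j) = (\<Sum>l<n. (A ^\<^sub>m k) $$ (i, l) * A $$ (l, j))"
      using A P Suc.prems by (simp add: scalar_prod_def atLeast0LessThan)
    also have "\<bar>\<dots>\<bar> \<le> (\<Sum>l<n. \<bar>(A ^\<^sub>m k) $$ (i, l)\<bar> * \<bar>A $$ (l, j)\<bar>)"
      by (rule order_trans[OF sum_abs]) (simp add: abs_mult)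
    also have "\<dots> \<le> (\<Sum>l<n. (real n * c) ^ k * c)"
    proof (rule sum_mono)
      fix l assume "l \<in> {..<n}"
      then have l: "l < n" by simp
      have "0 \<le> (real n * c) ^ k" using Suc.IH[OF Suc.prems(1) l] by linarith
      then show "\<bar>(A ^\<^sub>m k) $$ (i, l)\<bar> * \<bar>A $$ (l, j)\<bar> \<le> (real n * c) ^ k * c"
        using mult_mono[OF Suc.IH[OF Suc.prems(1) l] c[OF l Suc.prems(2)]] by simp
    qed
    also have "\<dots> = (real n * c) ^ Suc k" by simp
    finally show ?case .
  qed
  show ?thesis
  proof (rule summable_comparison_test')
    show "summable (\<lambda>k. (real n * c) ^ k / fact k)"
      using summable_exp[of "real n * c"] by (simp add: field_simps)
    show "norm ((A ^\<^sub>m k) $$ (i, j) / fact k) \<le> (real n * c) ^ k / fact k" if "k \<ge> 0" for k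
      using bound[OF ij, of k] by (simp add: divide_right_mono)
  qed
qed

text \<open>Points of \<open>\<real>\<^sup>n\<close> are the members of \<open>Euclidean_space n\<close>, that is, sequences \<open>nat \<Rightarrow> real\<close>
  vanishing from index \<open>n\<close> on; \<open>Matrix.vec n\<close> converts such a sequence to a column vector
  (injectively), so that a matrix can be applied to it.\<close>

definition linearizing ::
    "'a topology \<Rightarrow> (real \<Rightarrow> 'a \<Rightarrow> 'a) \<Rightarrow> nat \<Rightarrow> ('a \<Rightarrow> nat \<Rightarrow> real) \<Rightarrow> bool" where
  "linearizing X \<Phi> n F \<longleftrightarrow>
     F ` topspace X \<subseteq> topspace (Euclidean_space n) \<and>
     (\<exists>B \<in> carrier_mat n n. \<forall>t. \<forall>x \<in> topspace X.
        Matrix.vec n (F (\<Phi> t x)) = mat_exp (t \<cdot>\<^sub>m B) *\<^sub>v Matrix.vec n (F x))"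

definition linearizable_by_C0_embedding ::
    "'a topology \<Rightarrow> (real \<Rightarrow> 'a \<Rightarrow> 'a) \<Rightarrow> bool" where
  "linearizable_by_C0_embedding X \<Phi> \<longleftrightarrow>
     (\<exists>n F. linearizing X \<Phi> n F \<and> embedding_map X (Euclidean_space n) F)"

end

theory Submission
  imports Defs
begin

text \<open>
  Even the scalar flow \<open>exp (- t)\<close>, that is \<open>B = - 1\<close>, suffices as the linear model. The key is a
  continuous Lyapunov function \<open>V\<close> with compact sublevel sets that decays at exactly the rate
  \<open>V (\<Phi> t x) = exp (- t) * V x\<close> and vanishes only at the equilibrium
  (lemma \<open>exponential_Lyapunov_function\<close>). Given \<open>V\<close>, every orbit other than the equilibrium meets the
  compact section \<open>L = {V = 1}\<close> exactly once, at \<open>\<pi> x = \<Phi> (ln (V x)) x\<close>, so that \<open>x\<close> is determined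
  by the pair \<open>(V x, \<pi> x)\<close> and \<open>\<pi>\<close> is constant along orbits.

  A compact subset of a manifold embeds into some \<open>\<real>\<^sup>m\<close>: finitely many charts, cut off by bump
  functions, separate its points (lemma \<open>finite_separating_on_compact\<close>). If \<open>f\<^sub>1, \<dots>, f\<^sub>m\<close> separate the
  points of \<open>L\<close>, then \<open>F = (V, V * (f\<^sub>1 \<circ> \<pi>), \<dots>, V * (f\<^sub>m \<circ> \<pi>))\<close> is injective and satisfies
  \<open>F (\<Phi> t x) = exp (- t) * F x\<close>. It is the cone over the embedding of \<open>L\<close>, with the equilibrium as
  apex; continuity at the apex holds because the \<open>f\<^sub>i\<close> are bounded on \<open>L\<close>. Since the sublevel sets of
  \<open>V\<close> are compact, \<open>F\<close> is proper, and a proper continuous injection is an embedding.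
\<close>

section \<open>Multiples of the identity matrix\<close>

lemma pow_smult_one_mat:
  fixes c :: real
  shows "(c \<cdot>\<^sub>m 1\<^sub>m n) ^\<^sub>m k = c ^ k \<cdot>\<^sub>m 1\<^sub>m n"
proof (induction k)
  case 0
  show ?case by auto
next
  case (Suc k)
  have "(c \<cdot>\<^sub>m 1\<^sub>m n) ^\<^sub>m Suc k = (c ^ k \<cdot>\<^sub>m 1\<^sub>m n) * (c \<cdot>\<^sub>m 1\<^sub>m n)"
    using Suc by simp
  also have "\<dots> = c ^ Suc k \<cdot>\<^sub>m 1\<^sub>m n"
    by (intro eq_matI) (auto simp: mult_smult_assoc_mat[of _ n n _ n] mult.commute)
  finally show ?case .
qed

lemma mat_exp_smult_one_mat: "mat_exp (c \<cdot>\<^sub>m 1\<^sub>m n) = exp c \<cdot>\<^sub>m 1\<^sub>m n"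
proof (rule eq_matI)
  fix i j assume "i < dim_row (exp c \<cdot>\<^sub>m (1\<^sub>m n :: real mat))" "j < dim_col (exp c \<cdot>\<^sub>m (1\<^sub>m n :: real mat))"
  then have ij: "i < n" "j < n" by auto
  have "exp c = (\<Sum>k. c ^ k / fact k)"
    by (simp add: exp_def divide_inverse mult.commute)
  then show "mat_exp (c \<cdot>\<^sub>m 1\<^sub>m n) $$ (i, j) = (exp c \<cdot>\<^sub>m 1\<^sub>m n) $$ (i, j)"
    using ij by (simp add: mat_exp_def pow_smult_one_mat)
qed (auto simp: mat_exp_def)

text \<open>The matrix of the linear flow here is \<open>B = - 1\<close>.\<close>

lemma linearizing_if_homogeneous:
  assumes F: "F ` topspace X \<subseteq> topspace (Euclidean_space n)"
    and hom: "\<And>t x i. \<lbrakk>x \<in> topspace X; i < n\<rbrakk> \<Longrightarrow> F (\<Phi> t x) i = exp (- t) * F x i"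
  shows "linearizing X \<Phi> n F"
  unfolding linearizing_def
proof (intro conjI bexI allI ballI)
  fix t x assume x: "x \<in> topspace X"
  have B: "t \<cdot>\<^sub>m (- 1 \<cdot>\<^sub>m 1\<^sub>m n) = - t \<cdot>\<^sub>m (1\<^sub>m n :: real mat)"
    by (intro eq_matI) auto
  have "Matrix.vec n (F (\<Phi> t x)) = exp (- t) \<cdot>\<^sub>v Matrix.vec n (F x)"
    using hom[OF x] by (intro eq_vecI) auto
  also have "\<dots> = (exp (- t) \<cdot>\<^sub>m 1\<^sub>m n) *\<^sub>v Matrix.vec n (F x)"
    by (intro eq_vecI) auto
  finally show "Matrix.vec n (F (\<Phi> t x)) = mat_exp (t \<cdot>\<^sub>m (- 1 \<cdot>\<^sub>m 1\<^sub>m n)) *\<^sub>v Matrix.vec n (F x)"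
    unfolding B mat_exp_smult_one_mat .
qed (use F in auto)

section \<open>Separating the points of a compact set by finitely many functions\<close>

text \<open>A function defined only on \<open>W\<close>, such as a chart coordinate, becomes a global continuous function
  once it is multiplied by the bump \<open>c - h\<close>, which falls to \<open>0\<close> while still inside \<open>W\<close>. The closed
  set \<open>{h \<le> c}\<close> stays away from the frontier of \<open>W\<close>, where the function may be unbounded.\<close>

lemma continuous_map_cutoff_mult:
  fixes h \<psi> :: "'a \<Rightarrow> real"
  assumes h: "continuous_map X euclideanreal h"
    and W: "{x \<in> topspace X. h x \<le> c} \<subseteq> W"
    and \<psi>: "continuous_map (subtopology X W) euclideanreal \<psi>"
  shows "continuous_map X euclideanreal (\<lambda>x. if h x \<le> c then (c - h x) * \<psi> x else 0)"
proof (rule continuous_map_cases_le[OF h])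
  show "continuous_map (subtopology X {x \<in> topspace X. h x \<le> c}) euclideanreal (\<lambda>x. (c - h x) * \<psi> x)"
    by (intro continuous_intros continuous_map_from_subtopology[OF h]
        continuous_map_from_subtopology_mono[OF \<psi>] W)
qed auto

text \<open>Being a topological subspace of a \<open>d\<close>-manifold enters the proof only through this consequence,
  which can be stated without mentioning the ambient manifold. The coordinates \<open>\<psi> i\<close> are kept as
  separate real functions because they are later multiplied by bumps one at a time.\<close>

definition locally_injects :: "'a topology \<Rightarrow> nat \<Rightarrow> 'a \<Rightarrow> bool" where
  "locally_injects X d p \<longleftrightarrow> (\<exists>W \<psi>. openin X W \<and> p \<in> W \<and>
     (\<forall>i<d. continuous_map (subtopology X W) euclideanreal (\<psi> i)) \<and>
     (\<forall>x\<in>W. \<forall>y\<in>W. (\<forall>i<d. \<psi> i x = \<psi> i y) \<longrightarrow> x = y))"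

lemma locally_injects_if_injects_into_manifold:
  assumes M: "topological_manifold d M"
    and h: "continuous_map X M h" "inj_on h (topspace X)"
    and p: "p \<in> topspace X"
  shows "locally_injects X d p"
proof -
  have "h p \<in> topspace M"
    using continuous_map_image_subset_topspace[OF h(1)] p by auto
  then obtain U V where UV: "openin M U" "h p \<in> U" "openin (Euclidean_space d) V"
    "subtopology M U homeomorphic_space subtopology (Euclidean_space d) V"
    using M unfolding topological_manifold_def by blast
  then obtain \<phi> where \<phi>: "homeomorphic_map (subtopology M U) (subtopology (Euclidean_space d) V) \<phi>"
    using homeomorphic_space by blast
  define W where "W = {x \<in> topspace X. h x \<in> U}"
  have "continuous_map (subtopology X W) (subtopology M U) h"
    by (auto simp: continuous_map_in_subtopology W_def intro: continuous_map_from_subtopology h)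
  then have "continuous_map (subtopology X W) (Euclidean_space d) (\<phi> \<circ> h)"
    using homeomorphic_imp_continuous_map[OF \<phi>] continuous_map_compose continuous_map_into_fulltopology
    by blast
  then have 1: "continuous_map (subtopology X W) (powertop_real UNIV) (\<phi> \<circ> h)"
    unfolding Euclidean_space_def by (rule continuous_map_into_fulltopology)
  have U: "U \<subseteq> topspace M" using UV(1) by (rule openin_subset)
  have 2: "x = y" if "x \<in> W" "y \<in> W" "\<forall>i<d. \<phi> (h x) i = \<phi> (h y) i" for x y
  proof -
    have "\<phi> ` (topspace (subtopology M U)) \<subseteq> topspace (Euclidean_space d)"
      using homeomorphic_imp_surjective_map[OF \<phi>] by auto
    then have "\<phi> (h z) i = 0" if "z \<in> W" "i \<ge> d" for z i
      using that U by (force simp: W_def topspace_Euclidean_space)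
    then have "\<phi> (h x) = \<phi> (h y)"
      using that by (metis ext not_le)
    moreover have "inj_on \<phi> (topspace (subtopology M U))"
      using homeomorphic_imp_injective_map[OF \<phi>] .
    ultimately have "h x = h y"
      using that U by (auto simp: W_def inj_on_def)
    then show ?thesis using h(2) that by (auto simp: W_def inj_on_def)
  qed
  show ?thesis unfolding locally_injects_def
  proof (intro exI[of _ W] exI[of _ "\<lambda>i x. \<phi> (h x) i"] conjI allI impI ballI)
    show "openin X W" unfolding W_def by (rule openin_continuous_map_preimage[OF h(1) UV(1)])
    show "p \<in> W" using p UV by (simp add: W_def)
    show "continuous_map (subtopology X W) euclideanreal (\<lambda>x. \<phi> (h x) i)" for i
      using 1 by (simp add: continuous_map_componentwise_UNIV o_def)
  qed (use 2 in auto)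
qed

text \<open>The bump \<open>1/2 - h\<close> is itself determined by a member of the family, namely \<open>h\<close>. So a point \<open>y\<close> that
  the family cannot distinguish from a point \<open>x\<close> close to \<open>p\<close> lies in the same chart, where dividing
  by the bump recovers the coordinates of both. This is why \<open>y\<close> may range over the whole space.\<close>

lemma finite_separating_near_point:
  assumes X: "completely_regular_space X" and p: "locally_injects X d p"
  obtains A :: "('a \<Rightarrow> real) set" and W where "finite A" "openin X W" "p \<in> W"
    "\<And>f. f \<in> A \<Longrightarrow> continuous_map X euclideanreal f"
    "\<And>x y. \<lbrakk>x \<in> W; y \<in> topspace X; \<And>f. f \<in> A \<Longrightarrow> f x = f y\<rbrakk> \<Longrightarrow> x = y"
proof -
  obtain U \<psi> where U: "openin X U" "p \<in> U"
    and \<psi>: "\<And>i. i < d \<Longrightarrow> continuous_map (subtopology X U) euclideanreal (\<psi> i)"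
    and inj: "\<And>x y. \<lbrakk>x \<in> U; y \<in> U; \<And>i. i < d \<Longrightarrow> \<psi> i x = \<psi> i y\<rbrakk> \<Longrightarrow> x = y"
    using p unfolding locally_injects_def by blast
  obtain h where h: "continuous_map X euclideanreal h" "h p = 0" "h ` (topspace X - U) \<subseteq> {1}"
    using X U unfolding completely_regular_space_alt' by blast
  have in_U: "x \<in> U" if "x \<in> topspace X" "h x < 1" for x
    using h(3) that by force
  define g where "g i x = (if h x \<le> 1/2 then (1/2 - h x) * \<psi> i x else 0)" for i x
  define W where "W = {x \<in> topspace X. h x \<in> {..<1/2}}"
  show thesis
  proof (rule that[of "insert h (g ` {..<d})" W])
    show "openin X W"
      unfolding W_def by (rule openin_continuous_map_preimage[OF h(1)]) auto
    show "p \<in> W" using U h openin_subset by (fastforce simp: W_def)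
    show "continuous_map X euclideanreal f" if f: "f \<in> insert h (g ` {..<d})" for f
    proof -
      have "continuous_map X euclideanreal (g i)" if "i < d" for i
        unfolding g_def
        by (rule continuous_map_cutoff_mult[OF h(1) _ \<psi>[OF that]]) (auto intro: in_U)
      then show ?thesis using f h(1) by auto
    qed
    show "x = y" if x: "x \<in> W" and y: "y \<in> topspace X"
      and eq: "\<And>f. f \<in> insert h (g ` {..<d}) \<Longrightarrow> f x = f y" for x y
    proof (rule inj)
      have hxy: "h y = h x" "h x < 1/2" using eq[of h] x by (auto simp: W_def)
      show "x \<in> U" "y \<in> U" using hxy x y by (auto intro!: in_U simp: W_def)
      show "\<psi> i x = \<psi> i y" if "i < d" for i
        using eq[of "g i"] hxy that by (simp add: g_def)
    qed
  qed auto
qed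

lemma finite_separating_on_compact:
  assumes X: "completely_regular_space X" and K: "compactin X K"
    and loc: "\<And>p. p \<in> K \<Longrightarrow> locally_injects X d p"
  obtains A :: "('a \<Rightarrow> real) set" where "finite A"
    "\<And>f. f \<in> A \<Longrightarrow> continuous_map X euclideanreal f"
    "\<And>x y. \<lbrakk>x \<in> K; y \<in> K; \<And>f. f \<in> A \<Longrightarrow> f x = f y\<rbrakk> \<Longrightarrow> x = y"
proof -
  have "\<exists>A W. finite A \<and> openin X W \<and> p \<in> W \<and> (\<forall>f\<in>A. continuous_map X euclideanreal f) \<and>
      (\<forall>x\<in>W. \<forall>y\<in>topspace X. (\<forall>f\<in>A. f x = f y) \<longrightarrow> x = y)" if "p \<in> K" for p
    using finite_separating_near_point[OF X loc[OF that]] by metis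
  then obtain A W where AW: "\<And>p. p \<in> K \<Longrightarrow> finite (A p) \<and> openin X (W p) \<and> p \<in> W p \<and>
      (\<forall>f\<in>A p. continuous_map X euclideanreal f) \<and>
      (\<forall>x\<in>W p. \<forall>y\<in>topspace X. (\<forall>f\<in>A p. f x = f y) \<longrightarrow> x = y)"
    by metis
  have "\<forall>U\<in>W ` K. openin X U" "K \<subseteq> \<Union>(W ` K)" using AW by auto
  then have "\<exists>\<F>. finite \<F> \<and> \<F> \<subseteq> W ` K \<and> K \<subseteq> \<Union>\<F>"
    using K unfolding compactin_def by meson
  then obtain P where P: "finite P" "P \<subseteq> K" "K \<subseteq> \<Union>(W ` P)"
    by (metis finite_subset_image)
  show thesis
  proof (rule that[of "\<Union>(A ` P)"])
    show "finite (\<Union>(A ` P))" using P AW by blast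
    show "continuous_map X euclideanreal f" if "f \<in> \<Union>(A ` P)" for f
      using that P AW by blast
    show "x = y" if xy: "x \<in> K" "y \<in> K" and eq: "\<And>f. f \<in> \<Union>(A ` P) \<Longrightarrow> f x = f y" for x y
    proof -
      obtain p where p: "p \<in> P" "x \<in> W p" using P xy by blast
      have "y \<in> topspace X" using K xy compactin_subset_topspace by blast
      then show ?thesis using AW[of p] p P(2) eq by blast
    qed
  qed
qed

section \<open>An exponentially decaying Lyapunov function\<close>

text \<open>The Hausdorff property, inherited from the ambient manifold, makes a locally compact space
  completely regular, so that bump functions exist.\<close>

locale stable_flow =
  fixes X :: "'a topology" and \<Phi> :: "real \<Rightarrow> 'a \<Rightarrow> 'a" and x0 :: 'a
  assumes locally_compact: "locally_compact_space X"
    and Hausdorff: "Hausdorff_space X"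
    and flow: "C0_flow X \<Phi>"
    and equilibrium: "equilibrium_point X \<Phi> x0"
    and stable: "globally_asymptotically_stable X \<Phi> x0"
begin

lemma completely_regular: "completely_regular_space X"
  using locally_compact Hausdorff locally_compact_regular_imp_completely_regular_space by blast

lemma x0_in: "x0 \<in> topspace X" and flow_x0 [simp]: "\<Phi> t x0 = x0"
  using equilibrium by (auto simp: equilibrium_point_def)

lemma continuous_flow: "continuous_map (prod_topology euclideanreal X) X (\<lambda>(t, x). \<Phi> t x)"
  using flow by (simp add: C0_flow_def)

lemma continuous_flow_compose:
  assumes "continuous_map Y euclideanreal \<tau>" "continuous_map Y X f"
  shows "continuous_map Y X (\<lambda>y. \<Phi> (\<tau> y) (f y))"
proof -
  have "continuous_map Y X ((\<lambda>(t, x). \<Phi> t x) \<circ> (\<lambda>y. (\<tau> y, f y)))"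
    by (intro continuous_map_compose[OF _ continuous_flow]) (simp add: continuous_map_pairedI assms)
  then show ?thesis by (simp add: o_def)
qed

lemma continuous_time_map: "continuous_map X X (\<Phi> t)"
  using continuous_flow_compose[of X "\<lambda>_. t" "\<lambda>x. x"] by simp

lemma flow_in [simp]: "x \<in> topspace X \<Longrightarrow> \<Phi> t x \<in> topspace X"
  using continuous_map_image_subset_topspace[OF continuous_time_map] by blast

lemma flow_0 [simp]: "x \<in> topspace X \<Longrightarrow> \<Phi> 0 x = x"
  using flow by (simp add: C0_flow_def)

lemma flow_flow: "x \<in> topspace X \<Longrightarrow> \<Phi> s (\<Phi> t x) = \<Phi> (s + t) x"
  using flow by (simp add: C0_flow_def)

text \<open>Each point of \<open>K\<close> enters, at some time, a neighbourhood \<open>W\<close> of the equilibrium that stability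
  confines to \<open>U\<close> for ever after, and all nearby points are in \<open>W\<close> at the same time. By compactness
  finitely many such times serve all of \<open>K\<close>.\<close>

lemma uniform_attraction:
  assumes K: "compactin X K" and U: "openin X U" "x0 \<in> U"
  obtains T where "\<And>t x. \<lbrakk>t \<ge> T; x \<in> K\<rbrakk> \<Longrightarrow> \<Phi> t x \<in> U"
proof -
  have "nbhd_in X x0 U"
    using U openin_subset unfolding nbhd_in_def by blast
  then obtain V where V: "nbhd_in X x0 V" "\<And>t. t \<ge> 0 \<Longrightarrow> \<Phi> t ` V \<subseteq> U"
    using stable unfolding globally_asymptotically_stable_def by blast
  then obtain W where W: "openin X W" "x0 \<in> W" "W \<subseteq> V"
    unfolding nbhd_in_def by blast
  define D where "D s = {x \<in> topspace X. \<Phi> s x \<in> W}" for s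
  have D: "openin X (D s)" for s
    unfolding D_def by (rule openin_continuous_map_preimage[OF continuous_time_map W(1)])
  have K_in: "K \<subseteq> topspace X" using K by (rule compactin_subset_topspace)
  have "\<exists>s. x \<in> D s" if "x \<in> K" for x
  proof -
    have x: "x \<in> topspace X" using that K_in by blast
    then have "eventually (\<lambda>t. \<Phi> t x \<in> W) at_top"
      using stable W unfolding globally_asymptotically_stable_def limitin_def by blast
    then have "\<exists>s. \<Phi> s x \<in> W" by (intro eventually_happens') simp_all
    then show ?thesis using x by (auto simp: D_def)
  qed
  then have "\<forall>U\<in>range D. openin X U" "K \<subseteq> \<Union>(range D)" using D by auto
  then have "\<exists>\<F>. finite \<F> \<and> \<F> \<subseteq> range D \<and> K \<subseteq> \<Union>\<F>"
    using K unfolding compactin_def by meson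
  then obtain S where S: "finite S" "K \<subseteq> \<Union>(D ` S)"
    by (metis finite_subset_image)
  show thesis
  proof (rule that[of "Max (insert 0 S)"])
    fix t x assume t: "Max (insert 0 S) \<le> t" and x: "x \<in> K"
    obtain s where s: "s \<in> S" "x \<in> D s" using S x by blast
    then have "s \<le> t" using S t by simp
    then have "\<Phi> (t - s) (\<Phi> s x) \<in> U"
      using V(2)[of "t - s"] W s by (auto simp: D_def)
    then show "\<Phi> t x \<in> U" using K_in x by (simp add: flow_flow subset_iff)
  qed
qed

text \<open>If the whole orbit stayed in \<open>K\<close>, then \<open>x\<close> would be the image at time \<open>T\<close> of a point of \<open>K\<close> for
  every \<open>T\<close>, and uniform attraction would place \<open>x\<close> in every neighbourhood of the equilibrium.\<close>

lemma orbit_leaves_compact: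
  assumes K: "compactin X K" and x: "x \<in> topspace X" "x \<noteq> x0"
  shows "\<exists>t. \<Phi> t x \<notin> K"
proof (rule ccontr)
  assume *: "\<nexists>t. \<Phi> t x \<notin> K"
  have "closedin X {x}"
    using closedin_Hausdorff_singleton[OF Hausdorff x(1)] .
  then have "openin X (topspace X - {x})"
    by (intro openin_diff openin_topspace)
  then obtain T where T: "\<And>t y. \<lbrakk>t \<ge> T; y \<in> K\<rbrakk> \<Longrightarrow> \<Phi> t y \<in> topspace X - {x}"
    using uniform_attraction[OF K] x(2) x0_in by (metis DiffI singletonD)
  have "\<Phi> T (\<Phi> (- T) x) \<noteq> x" using T[of T "\<Phi> (- T) x"] * by blast
  then show False using x by (simp add: flow_flow)
qed

text \<open>The supremum of \<open>exp t * k (\<Phi> t x)\<close> over all \<open>t\<close> has the exact decay rate for any \<open>k\<close>, by shifting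
  \<open>t\<close>. Take for \<open>k\<close> a bump with values in \<open>[0, 1]\<close> that is \<open>0\<close> near the equilibrium and \<open>1\<close> outside a
  compact neighbourhood \<open>N\<close>. Vanishing near the equilibrium makes the supremum finite, since large
  times contribute nothing, uniformly on compact sets. The value \<open>1\<close> outside \<open>N\<close> makes it positive,
  because every nontrivial orbit leaves \<open>N\<close>, and puts \<open>{V \<le> 1/2}\<close> inside \<open>N\<close>; the flow carries that
  compact set onto all other sublevel sets at positive levels.\<close>

lemma exponential_Lyapunov_function:
  obtains V :: "'a \<Rightarrow> real" where "continuous_map X euclideanreal V" "V x0 = 0"
    "\<And>x. \<lbrakk>x \<in> topspace X; x \<noteq> x0\<rbrakk> \<Longrightarrow> V x > 0"
    "\<And>t x. x \<in> topspace X \<Longrightarrow> V (\<Phi> t x) = exp (- t) * V x"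
    "\<And>c. compactin X {x \<in> topspace X. V x \<le> c}"
proof -
  obtain U0 N where N: "openin X U0" "x0 \<in> U0" "U0 \<subseteq> N" "compactin X N"
    using locally_compact x0_in unfolding locally_compact_space_def by blast
  obtain f where f: "continuous_map X (top_of_set {0..1::real}) f" "f x0 = 0"
      "f ` (topspace X - U0) \<subseteq> {1}"
    using completely_regular N x0_in unfolding completely_regular_space_def
    by (metis DiffD2 DiffI closedin_def double_diff openin_subset order_refl Diff_subset)
  have f01: "0 \<le> f x \<and> f x \<le> 1" if "x \<in> topspace X" for x
    using f(1) that by (auto simp: continuous_map_in_subtopology)
  have fc: "continuous_map X euclideanreal f"
    using f(1) by (simp add: continuous_map_in_subtopology)
  \<comment> \<open>\<open>f\<close> is known to vanish only at \<open>x0\<close>; its truncation \<open>k\<close> vanishes on a whole neighbourhood.\<close>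
  define k where "k x = max 0 (2 * f x - 1)" for x
  have k: "continuous_map X euclideanreal k"
    unfolding k_def by (intro continuous_intros fc)
  have k0: "0 \<le> k x" for x by (simp add: k_def)
  have k1: "k x \<le> 1" if "x \<in> topspace X" for x using f01[OF that] by (simp add: k_def)
  have k_out: "k x = 1" if "x \<in> topspace X" "x \<notin> N" for x
    using f(3) that N(3) by (force simp: k_def)
  define U where "U = {x \<in> topspace X. f x \<in> {..<1/2}}"
  have U: "openin X U" "x0 \<in> U"
    unfolding U_def by (rule openin_continuous_map_preimage[OF fc], simp) (simp add: f x0_in)
  have k_U: "k x = 0" if "x \<in> U" for x using that by (simp add: k_def U_def)
  define w where "w t x = exp t * k (\<Phi> t x)" for t x
  define V where "V x = (SUP t. w t x)" for x
  have w: "continuous_map X euclideanreal (w t)" for t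
    unfolding w_def
    using continuous_map_compose[OF continuous_time_map k] by (intro continuous_intros) (simp add: o_def)
  have w0: "0 \<le> w t x" for t x by (simp add: w_def k0)
  have vanish: "\<exists>T. \<forall>t\<ge>T. \<forall>x\<in>K. w t x = 0" if "compactin X K" for K
    using uniform_attraction[OF that U] k_U unfolding w_def by (metis mult_zero_right)
  have w_le: "w t x \<le> exp t" if "x \<in> topspace X" for t x
    using k1[of "\<Phi> t x"] that by (simp add: w_def)
  have bdd: "bdd_above (range (\<lambda>t. w t x))" if x: "x \<in> topspace X" for x
  proof -
    obtain T where T: "\<And>t. t \<ge> T \<Longrightarrow> w t x = 0"
      using vanish[of "{x}"] x by auto
    have "w t x \<le> exp T" for t
      using T[of t] w_le[OF x, of t] by (cases "t \<ge> T") (auto intro: order_trans)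
    then show ?thesis by (intro bdd_aboveI[of _ "exp T"]) auto
  qed
  have w_le_V: "w t x \<le> V x" if "x \<in> topspace X" for t x
    unfolding V_def by (rule cSUP_upper[OF _ bdd[OF that]]) simp
  have V_le: "V x \<le> c" if "\<And>t. w t x \<le> c" for x c
    unfolding V_def using that by (intro cSUP_least) auto
  have V_hom: "V (\<Phi> t x) = exp (- t) * V x" if x: "x \<in> topspace X" for t x
  proof -
    have le: "V (\<Phi> t x) \<le> exp (- t) * V x" if x: "x \<in> topspace X" for t x
    proof (rule V_le)
      fix s
      have "w s (\<Phi> t x) = exp (- t) * w (s + t) x"
        using x by (simp add: w_def flow_flow flip: exp_add mult.assoc)
      also have "\<dots> \<le> exp (- t) * V x" using w_le_V[OF x] by simp
      finally show "w s (\<Phi> t x) \<le> exp (- t) * V x" .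
    qed
    have "V (\<Phi> (- t) (\<Phi> t x)) \<le> exp t * V (\<Phi> t x)"
      using le[of "\<Phi> t x" "- t"] x by simp
    then have "exp (- t) * V x \<le> V (\<Phi> t x)"
      using x by (simp add: flow_flow exp_minus field_simps)
    then show ?thesis using le[OF x] by (simp add: antisym)
  qed
  have V_x0: "V x0 = 0"
  proof -
    have "w t x0 = 0" for t by (simp add: w_def k_U[OF U(2)])
    then show ?thesis by (simp add: V_def)
  qed
  have V_pos: "V x > 0" if x: "x \<in> topspace X" "x \<noteq> x0" for x
  proof -
    obtain t where "\<Phi> t x \<notin> N" using orbit_leaves_compact[OF N(4) x] by blast
    then have "w t x = exp t" using k_out[of "\<Phi> t x"] x by (simp add: w_def)
    then show ?thesis using w_le_V[OF x(1), of t] by (metis exp_gt_zero less_le_trans)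
  qed
  \<comment> \<open>A supremum of continuous functions is lower semicontinuous. For the other half, only times in a
    compact interval \<open>[S, T]\<close> matter near \<open>x\<close>: before \<open>S\<close> the factor \<open>exp t\<close> is below the bound \<open>b\<close>,
    after \<open>T\<close> the bump vanishes. On \<open>[S, T]\<close> the tube lemma applies.\<close>
  have V_cont: "continuous_map X euclideanreal V"
    unfolding continuous_map_upper_lower_semicontinuous_lt
  proof (intro conjI allI)
    fix a
    have "{x \<in> topspace X. V x > a} = (\<Union>t. {x \<in> topspace X. w t x \<in> {a<..}})"
      using bdd by (auto simp: V_def less_cSUP_iff)
    moreover have "openin X {x \<in> topspace X. w t x \<in> {a<..}}" for t
      by (rule openin_continuous_map_preimage[OF w]) simp
    ultimately show "openin X {x \<in> topspace X. V x > a}" by auto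
  next
    fix a
    show "openin X {x \<in> topspace X. V x < a}"
    proof (subst openin_subopen, intro ballI)
      fix x assume "x \<in> {x \<in> topspace X. V x < a}"
      then have x: "x \<in> topspace X" "V x < a" by auto
      then obtain b where b: "V x < b" "b < a" using dense by blast
      have "V x \<ge> 0" using w0 w_le_V[OF x(1)] order_trans by blast
      then have "b > 0" using b by simp
      define S where "S = ln b"
      obtain O1 K where K: "openin X O1" "x \<in> O1" "O1 \<subseteq> K" "compactin X K"
        using locally_compact x unfolding locally_compact_space_def by blast
      obtain T where T: "\<And>t y. \<lbrakk>t \<ge> T; y \<in> K\<rbrakk> \<Longrightarrow> w t y = 0"
        using vanish[OF K(4)] by blast
      define G where "G = {z \<in> topspace (prod_topology X euclideanreal). (\<lambda>(y, t). w t y) z \<in> {..<b}}"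
      have "continuous_map (prod_topology X euclideanreal) euclideanreal (\<lambda>z. w (snd z) (fst z))"
      proof -
        have "continuous_map (prod_topology X euclideanreal) X (\<lambda>z. \<Phi> (snd z) (fst z))"
          by (intro continuous_flow_compose continuous_map_fst continuous_map_snd)
        from continuous_map_compose[OF this k]
        have 1: "continuous_map (prod_topology X euclideanreal) euclideanreal (\<lambda>z. k (\<Phi> (snd z) (fst z)))"
          by (simp add: o_def)
        have "continuous_map euclideanreal euclideanreal exp" by (simp add: continuous_on_exp)
        from continuous_map_compose[OF continuous_map_snd this]
        have 2: "continuous_map (prod_topology X euclideanreal) euclideanreal (\<lambda>z. exp (snd z))"
          by (simp add: o_def)
        show ?thesis unfolding w_def by (intro continuous_intros 1 2)
      qed
      then have G: "openin (prod_topology X euclideanreal) G"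
        unfolding G_def case_prod_unfold by (rule openin_continuous_map_preimage) simp
      have "{x} \<times> {S..T} \<subseteq> G"
        using x b w_le_V[OF x(1)] by (auto simp: G_def intro: le_less_trans)
      then obtain O2 J where O2: "openin X O2" "x \<in> O2" "{S..T} \<subseteq> J" "O2 \<times> J \<subseteq> G"
        using tube_lemma_right[OF G _ x(1), of "{S..T}"] by auto
      have le_b: "V y \<le> b" if y: "y \<in> O1 \<inter> O2" for y
      proof (rule V_le)
        fix t
        have yX: "y \<in> topspace X" using y K(1) openin_subset by blast
        consider "t \<le> S" | "t \<in> {S..T}" | "t \<ge> T" by fastforce
        then show "w t y \<le> b"
        proof cases
          case 1
          then have "exp t \<le> b" using \<open>b > 0\<close> by (metis S_def exp_le_cancel_iff exp_ln)
          then show ?thesis using w_le[OF yX, of t] by simp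
        next
          case 2
          then have "(y, t) \<in> G" using O2 y by blast
          then show ?thesis by (simp add: G_def)
        next
          case 3
          then show ?thesis using T[of t y] K y \<open>b > 0\<close> by auto
        qed
      qed
      show "\<exists>Q. openin X Q \<and> x \<in> Q \<and> Q \<subseteq> {x \<in> topspace X. V x < a}"
      proof (intro exI conjI)
        show "openin X (O1 \<inter> O2)" "x \<in> O1 \<inter> O2" using K O2 by auto
        show "O1 \<inter> O2 \<subseteq> {x \<in> topspace X. V x < a}"
          using le_b b openin_subset[OF K(1)] by fastforce
      qed
    qed
  qed
  have V_cpt: "compactin X {x \<in> topspace X. V x \<le> c}" for c
  proof -
    have cl: "closedin X {x \<in> topspace X. V x \<in> {..c}}" for c
      by (rule closedin_continuous_map_preimage[OF V_cont]) simp
    have half: "{x \<in> topspace X. V x \<in> {..1/2}} \<subseteq> N"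
    proof
      fix x assume "x \<in> {x \<in> topspace X. V x \<in> {..1/2}}"
      then have x: "x \<in> topspace X" "V x \<le> 1/2" by auto
      then have "k x \<le> 1/2" using w_le_V[OF x(1), of 0] by (simp add: w_def)
      then show "x \<in> N" using k_out[OF x(1)] by fastforce
    qed
    have cpt: "compactin X {x \<in> topspace X. V x \<in> {..1/2}}"
      by (rule closed_compactin[OF N(4) half cl])
    \<comment> \<open>Enlarging \<open>c\<close> to at least \<open>1\<close> keeps the time shift \<open>ln (2 * m)\<close> meaningful when \<open>c \<le> 0\<close>.\<close>
    define m where "m = max c 1"
    have m: "m > 0" "c \<le> m" by (auto simp: m_def)
    define s where "s = ln (2 * m)"
    have s: "exp s = 2 * m" using m by (simp add: s_def)
    have "{x \<in> topspace X. V x \<in> {..c}} \<subseteq> \<Phi> (- s) ` {x \<in> topspace X. V x \<in> {..1/2}}"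
    proof
      fix x assume "x \<in> {x \<in> topspace X. V x \<in> {..c}}"
      then have x: "x \<in> topspace X" "V x \<le> m" using m by auto
      show "x \<in> \<Phi> (- s) ` {x \<in> topspace X. V x \<in> {..1/2}}"
      proof (rule image_eqI)
        show "x = \<Phi> (- s) (\<Phi> s x)" using x by (simp add: flow_flow)
        have "V (\<Phi> s x) = V x / (2 * m)"
          using x m by (simp add: V_hom exp_minus s field_simps)
        also have "\<dots> \<le> 1/2" using x(2) m by (simp add: divide_le_eq)
        finally have "V (\<Phi> s x) \<le> 1/2" .
        then show "\<Phi> s x \<in> {x \<in> topspace X. V x \<in> {..1/2}}" using x by simp
      qed
    qed
    from closed_compactin[OF image_compactin[OF cpt continuous_time_map] this cl]
    show ?thesis by simp
  qed
  show thesis by (rule that[OF V_cont V_x0 V_pos V_hom V_cpt])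
qed

end

section \<open>The linearizing embedding\<close>

text \<open>A function on the cone is continuous if it is so away from the apex \<open>{V = 0}\<close> and is squeezed to
  \<open>0\<close> at the apex.\<close>

lemma continuous_map_extend_by_bound:
  fixes u V :: "'a \<Rightarrow> real"
  assumes V: "continuous_map X euclideanreal V" "\<And>x. x \<in> topspace X \<Longrightarrow> V x \<ge> 0"
    and u: "continuous_map (subtopology X {x \<in> topspace X. V x > 0}) euclideanreal u"
    and bound: "\<And>x. x \<in> topspace X \<Longrightarrow> \<bar>u x\<bar> \<le> C * V x"
  shows "continuous_map X euclideanreal u"
  unfolding continuous_map_def
proof (intro conjI allI impI)
  fix B :: "real set" assume "openin euclidean B"
  then have B: "open B" by simp
  let ?P = "{x \<in> topspace X. V x > 0}"
  have P: "openin X ?P"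
    using V(1) unfolding continuous_map_upper_lower_semicontinuous_lt by blast
  have 1: "openin X {x \<in> ?P. u x \<in> B}"
  proof -
    have "openin (subtopology X ?P) {x \<in> topspace (subtopology X ?P). u x \<in> B}"
      by (rule openin_continuous_map_preimage[OF u]) (simp add: B)
    moreover have "{x \<in> topspace (subtopology X ?P). u x \<in> B} = {x \<in> ?P. u x \<in> B}" by auto
    ultimately show ?thesis by (simp only: openin_open_subtopology[OF P])
  qed
  have u0: "u x = 0" if "x \<in> topspace X" "\<not> V x > 0" for x
    using bound[of x] V(2)[of x] that by simp
  show "openin X {x \<in> topspace X. u x \<in> B}"
  proof (cases "0 \<in> B")
    case False
    then have "{x \<in> topspace X. u x \<in> B} = {x \<in> ?P. u x \<in> B}" using u0 by force
    then show ?thesis using 1 by simp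
  next
    case True
    then obtain e where e: "e > 0" "ball 0 e \<subseteq> B" using B openE by blast
    have "continuous_map X euclideanreal (\<lambda>x. C * V x)" by (intro continuous_intros V)
    then have 2: "openin X {x \<in> topspace X. C * V x < e}"
      unfolding continuous_map_upper_lower_semicontinuous_lt by blast
    have "u x \<in> B" if "x \<in> topspace X" "C * V x < e" for x
      using e(2) bound[OF that(1)] that(2) by (force simp: dist_real_def)
    moreover have "C * V x < e" if "x \<in> topspace X" "\<not> V x > 0" for x
      using V(2)[of x] that e by (simp add: order_antisym_conv)
    ultimately have "{x \<in> topspace X. u x \<in> B} = {x \<in> ?P. u x \<in> B} \<union> {x \<in> topspace X. C * V x < e}"
      by blast
    then show ?thesis using 1 2 by auto
  qed
qed simp

lemma metrizable_Euclidean_space: "metrizable_space (Euclidean_space n)"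
  unfolding Euclidean_space_def
  by (simp add: euclidean_product_topology metrizable_space_euclidean metrizable_space_subtopology)

lemma (in stable_flow) linearizable_if_locally_injects:
  assumes loc: "\<And>p. p \<in> topspace X \<Longrightarrow> locally_injects X d p"
  shows "linearizable_by_C0_embedding X \<Phi>"
proof -
  obtain V :: "'a \<Rightarrow> real" where V: "continuous_map X euclideanreal V" and V_x0: "V x0 = 0"
    and V_pos: "\<And>x. \<lbrakk>x \<in> topspace X; x \<noteq> x0\<rbrakk> \<Longrightarrow> V x > 0"
    and V_hom: "\<And>t x. x \<in> topspace X \<Longrightarrow> V (\<Phi> t x) = exp (- t) * V x"
    and V_cpt: "\<And>c. compactin X {x \<in> topspace X. V x \<le> c}"
    using exponential_Lyapunov_function by blast
  have V_ge: "V x \<ge> 0" if "x \<in> topspace X" for x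
    using V_pos[OF that] V_x0 by fastforce
  define L where "L = {x \<in> topspace X. V x = 1}"
  have "closedin X {x \<in> topspace X. V x \<in> {1}}"
    by (rule closedin_continuous_map_preimage[OF V]) simp
  then have "closedin X L" by (simp add: L_def)
  then have L: "compactin X L"
    by (intro closed_compactin[OF V_cpt[of 1]]) (auto simp: L_def)
  obtain A :: "('a \<Rightarrow> real) set" where A: "finite A"
    "\<And>f. f \<in> A \<Longrightarrow> continuous_map X euclideanreal f"
    and sep: "\<And>x y. \<lbrakk>x \<in> L; y \<in> L; \<And>f. f \<in> A \<Longrightarrow> f x = f y\<rbrakk> \<Longrightarrow> x = y"
    using finite_separating_on_compact[OF completely_regular L, of d] loc compactin_subset_topspace[OF L]
    by (metis subsetD)
  obtain m and f :: "nat \<Rightarrow> 'a \<Rightarrow> real" where f: "A = f ` {i. i < m}"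
    using finite_imp_nat_seg_image_inj_on[OF A(1)] by blast
  \<comment> \<open>At \<open>x0\<close> the convention \<open>ln 0 = 0\<close> is harmless: it gives \<open>\<pi> x0 = x0\<close>, and in \<open>F\<close> the
    functions of \<open>\<pi>\<close> are multiplied by \<open>V\<close>.\<close>
  define \<pi> where "\<pi> x = \<Phi> (ln (V x)) x" for x
  have \<pi>_L: "\<pi> x \<in> L" if "x \<in> topspace X" "x \<noteq> x0" for x
    using V_pos[OF that] that by (simp add: \<pi>_def L_def V_hom exp_minus)
  have \<pi>_hom: "\<pi> (\<Phi> t x) = \<pi> x" if "x \<in> topspace X" for t x
  proof (cases "x = x0")
    case False
    then show ?thesis
      using V_pos[OF that] that by (simp add: \<pi>_def V_hom flow_flow ln_mult)
  qed simp
  have \<pi>_cont: "continuous_map (subtopology X {x \<in> topspace X. V x > 0}) X \<pi>"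
  proof -
    let ?P = "{x \<in> topspace X. V x > 0}"
    have "continuous_map (subtopology X ?P) (top_of_set {0<..}) V"
      using V by (auto simp: continuous_map_in_subtopology intro: continuous_map_from_subtopology)
    moreover have "continuous_map (top_of_set {0::real<..}) euclideanreal ln"
      by (auto intro!: continuous_intros)
    ultimately have "continuous_map (subtopology X ?P) euclideanreal (ln \<circ> V)"
      by (rule continuous_map_compose)
    then show ?thesis unfolding \<pi>_def
      by (intro continuous_flow_compose) (simp_all add: o_def continuous_map_from_subtopology)
  qed
  have comp_cont: "continuous_map X euclideanreal (\<lambda>x. V x * g (\<pi> x))" if "g \<in> A" for g
  proof -
    have g: "continuous_map X euclideanreal g" using A that by blast
    have "compact (g ` L)" using image_compactin[OF L g] by simp
    then obtain C where C: "\<And>x. x \<in> L \<Longrightarrow> \<bar>g x\<bar> \<le> C"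
      by (fastforce dest: compact_imp_bounded simp: bounded_iff)
    show ?thesis
    proof (rule continuous_map_extend_by_bound[OF V V_ge])
      show "continuous_map (subtopology X {x \<in> topspace X. V x > 0}) euclideanreal (\<lambda>x. V x * g (\<pi> x))"
        using continuous_map_compose[OF \<pi>_cont g]
        by (intro continuous_map_real_mult continuous_map_from_subtopology[OF V]) (simp add: o_def)
      show "\<bar>V x * g (\<pi> x)\<bar> \<le> C * V x" if "x \<in> topspace X" for x
      proof (cases "x = x0")
        case False
        then have "\<bar>g (\<pi> x)\<bar> * V x \<le> C * V x"
          using C[OF \<pi>_L[OF that]] V_ge[OF that] by (intro mult_right_mono) auto
        then show ?thesis using V_ge[OF that] by (simp add: abs_mult mult.commute)
      qed (simp add: V_x0)
    qed
  qed
  define G where "G x i = (if i = 0 then V x else V x * f (i - 1) (\<pi> x))" for x i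
  define F where "F = (\<lambda>x i. if i < Suc m then G x i else 0)"
  have F_cont: "continuous_map X (Euclidean_space (Suc m)) F"
    unfolding F_def continuous_map_componentwise_Euclidean_space
  proof (intro allI impI)
    fix i assume "i < Suc m"
    then show "continuous_map X euclideanreal (\<lambda>x. G x i)"
      using V comp_cont[of "f (i - 1)"] f by (cases "i = 0") (auto simp: G_def)
  qed
  have F_inj: "inj_on F (topspace X)"
  proof (rule inj_onI)
    fix x y assume x: "x \<in> topspace X" and y: "y \<in> topspace X" and eq: "F x = F y"
    have G: "G x i = G y i" if "i < Suc m" for i using fun_cong[OF eq, of i] that by (simp add: F_def)
    have Vxy: "V x = V y" using G[of 0] by (simp add: G_def)
    show "x = y"
    proof (cases "x = x0 \<or> y = x0")
      case True
      then show ?thesis using Vxy V_x0 V_pos x y by (metis less_irrefl)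
    next
      case False
      have "\<pi> x = \<pi> y"
      proof (rule sep[OF \<pi>_L \<pi>_L])
        fix g assume "g \<in> A"
        then obtain i where "i < m" "g = f i" using f by blast
        then show "g (\<pi> x) = g (\<pi> y)"
          using G[of "Suc i"] Vxy V_pos[OF y] False by (simp add: G_def)
      qed (use x y False in auto)
      then have "\<Phi> (- ln (V x)) (\<pi> x) = \<Phi> (- ln (V y)) (\<pi> y)" using Vxy by simp
      then show ?thesis using x y by (simp add: \<pi>_def flow_flow)
    qed
  qed
  \<comment> \<open>Coordinate \<open>0\<close> of \<open>F\<close> is \<open>V\<close>, so the preimage of a bounded set lies in a sublevel set of \<open>V\<close>.\<close>
  have "proper_map X (Euclidean_space (Suc m)) F"
  proof (rule compact_imp_proper_map)
    show "k_space (Euclidean_space (Suc m))" "kc_space (Euclidean_space (Suc m))"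
      by (simp_all add: metrizable_Euclidean_space metrizable_imp_k_space
          Hausdorff_Euclidean_space Hausdorff_imp_kc_space)
    show "F \<in> topspace X \<rightarrow> topspace (Euclidean_space (Suc m))"
      using continuous_map_image_subset_topspace[OF F_cont] by blast
    fix K assume K: "compactin (Euclidean_space (Suc m)) K"
    have cl: "closedin X {x \<in> topspace X. F x \<in> K}"
      using closedin_continuous_map_preimage[OF F_cont] compactin_imp_closedin[OF Hausdorff_Euclidean_space K] .
    have "continuous_map (Euclidean_space (Suc m)) euclideanreal (\<lambda>y. y 0)"
      unfolding Euclidean_space_def
      by (intro continuous_map_from_subtopology continuous_map_product_projection) simp
    from image_compactin[OF K this] have "compact ((\<lambda>y. y 0) ` K)" by simp
    then obtain c where c: "\<And>y. y \<in> K \<Longrightarrow> \<bar>y 0\<bar> \<le> c"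
      by (fastforce dest: compact_imp_bounded simp: bounded_iff)
    have "V x \<le> c" if "F x \<in> K" for x
      using c[OF that] by (simp add: F_def G_def)
    then have "{x \<in> topspace X. F x \<in> K} \<subseteq> {x \<in> topspace X. V x \<le> c}" by blast
    from closed_compactin[OF V_cpt this cl] show "compactin X {x \<in> topspace X. F x \<in> K}" .
  qed (use F_cont in simp)
  then have "embedding_map X (Euclidean_space (Suc m)) F"
    using F_cont F_inj by (intro injective_closed_imp_embedding_map proper_imp_closed_map)
  moreover have "linearizing X \<Phi> (Suc m) F"
    using continuous_map_image_subset_topspace[OF F_cont]
    by (intro linearizing_if_homogeneous) (auto simp: F_def G_def V_hom \<pi>_hom)
  ultimately show ?thesis unfolding linearizable_by_C0_embedding_def by blast
qed

theorem corollary4: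
  fixes X :: "'a topology" and M :: "'m topology" and S :: "'m set"
    and d :: nat and \<Phi> :: "real \<Rightarrow> 'a \<Rightarrow> 'a" and x0 :: 'a
  assumes "locally_compact_space X"
    and "topological_manifold d M"
    and "S \<subseteq> topspace M"
    and "X homeomorphic_space subtopology M S"
    and "C0_flow X \<Phi>"
    and "equilibrium_point X \<Phi> x0"
    and "globally_asymptotically_stable X \<Phi> x0"
  shows "linearizable_by_C0_embedding X \<Phi>"
proof -
  obtain h where h: "homeomorphic_map X (subtopology M S) h"
    using assms(4) homeomorphic_space by blast
  have h_cont: "continuous_map X M h"
    using homeomorphic_imp_continuous_map[OF h] by (rule continuous_map_into_fulltopology)
  have h_inj: "inj_on h (topspace X)"
    using h by (rule homeomorphic_imp_injective_map)
  have "Hausdorff_space X"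
    using assms(2) h_cont h_inj Hausdorff_space_injective_preimage
    unfolding topological_manifold_def by blast
  then interpret stable_flow X \<Phi> x0
    using assms by unfold_locales
  show ?thesis
    by (rule linearizable_if_locally_injects[OF locally_injects_if_injects_into_manifold[OF assms(2) h_cont h_inj]])
qed

end
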